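(* Let $J=\{1,\dots,n\}$, let $x_j\in\mathbb{R}_{\ge 0}^m$ and $y_j\in\mathbb{R}_{\ge 0}^s$ be nonzero vectors for each $j\in J$, and fix $o\in J$. Let $\theta^*$ be the optimal value of the BCC envelopment model for $\mathrm{DMU}_o$ and $R_o^M$ the maximal reference set of $\mathrm{DMU}_o$ (both defined in the context). For $M>0$ consider the mixed integer linear program in the variables $U\in\mathbb{R}^s$, $V\in\mathbb{R}^m$, $u_o\in\mathbb{R}$ (unrestricted in sign), $t\in\mathbb{R}^n$, $I\in\{0,1\}^n$: $$\begin{aligned} \max\ & \sum_{j\in J} I_j\\ \text{s.t. } & U^T y_o+u_o=\theta^*,\\ & V^T x_o=1,\\ & U^T y_j-V^T x_j+u_o+t_j=0,\quad j\in J,\\ & I_j\le M t_j,\quad j\in J,\\ & U\ge 0,\ V\ge 0,\ I_j\in\{0,1\},\ t_j\ge 0,\quad j\in J. \end{aligned}$$ Then for all sufficiently large $M$ (i.e. there is $M_0>0$, depending on the data, such that for every $M\ge M_0$) the following holds: if $(U^*,V^*,u_o^*,t^* )$ (together with some $I^*$) is an optimal solution of this program and $J_o=\{\mathrm{DMU}_j\mid t_j^*=0\}$, then $$J_o=R_o^M.$$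
   Context: There are $n$ decision making units $\mathrm{DMU}_j$, $j\in J=\{1,\dots,n\}$, where $\mathrm{DMU}_j$ has input vector $x_j=(x_{1j},\dots,x_{mj})^T\in\mathbb{R}_{\ge0}^m$ and output vector $y_j=(y_{1j},\dots,y_{sj})^T\in\mathbb{R}_{\ge0}^s$, both nonzero. DMUs are identified with their indices $j\in J$. Vector inequalities are componentwise. The (input-oriented) BCC envelopment model for $\mathrm{DMU}_o$, $o\in J$, is the linear program in the variables $\theta\in\mathbb{R}$, $\lambda\in\mathbb{R}^n$: $$\min\ \theta\quad\text{s.t.}\quad \sum_{j\in J}\lambda_j x_{ij}\le\theta x_{io}\ (i=1,\dots,m),\quad \sum_{j\in J}\lambda_j y_{rj}\ge y_{ro}\ (r=1,\dots,s),\quad \sum_{j\in J}\lambda_j=1,\quad \lambda_j\ge0\ (j\in J).$$ Its optimal value is denoted $\theta^*$. Reference set: if $(\theta^*,\lambda)$ is an optimal solution of the BCC envelopment model for $\mathrm{DMU}_o$, the set $\{\mathrm{DMU}_j\mid\lambda_j>0\}$ is called a reference set to $\mathrm{DMU}_o$; its members are called reference DMUs. Reference sets need not be unique, since the model may have several optimal solutions. Maximal reference set: $R_o^M$ is the set containing all the reference sets to $\mathrm{DMU}_o$, i.e. their union: $\mathrm{DMU}_j\in R_o^M$ if and only if there is an optimal solution of the BCC envelopment model for $\mathrm{DMU}_o$ with $\lambda_j>0$. (The superscript $M$ in $R_o^M$ is part of the notation and unrelated to the constant $M$ of the program.) *)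

theory Defs
  imports "HOL-Analysis.Analysis"
begin

text \<open>
  The DMUs are the elements of a finite index type \<open>'n\<close>; DMU \<open>j\<close> has input vector \<open>x j\<close> and
  output vector \<open>y j\<close>.  The DMU under evaluation is called \<open>k\<close>, since \<open>o\<close> is
  the ASCII syntax of function composition.
\<close>

definition bcc_feasible ::
  "('n::finite \<Rightarrow> real^'m) \<Rightarrow> ('n \<Rightarrow> real^'s) \<Rightarrow> 'n \<Rightarrow> real \<Rightarrow> real^'n \<Rightarrow> bool" where
  "bcc_feasible x y k \<theta> l \<longleftrightarrow>
     (\<forall>i. (\<Sum>j\<in>UNIV. l $ j * x j $ i) \<le> \<theta> * x k $ i) \<and>
     (\<forall>r. (\<Sum>j\<in>UNIV. l $ j * y j $ r) \<ge> y k $ r) \<and>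
     (\<Sum>j\<in>UNIV. l $ j) = 1 \<and>
     (\<forall>j. l $ j \<ge> 0)"

definition bcc_optimal ::
  "('n::finite \<Rightarrow> real^'m) \<Rightarrow> ('n \<Rightarrow> real^'s) \<Rightarrow> 'n \<Rightarrow> real \<Rightarrow> real^'n \<Rightarrow> bool" where
  "bcc_optimal x y k \<theta> l \<longleftrightarrow>
     bcc_feasible x y k \<theta> l \<and> (\<forall>\<theta>' l'. bcc_feasible x y k \<theta>' l' \<longrightarrow> \<theta> \<le> \<theta>')"

definition bcc_value ::
  "('n::finite \<Rightarrow> real^'m) \<Rightarrow> ('n \<Rightarrow> real^'s) \<Rightarrow> 'n \<Rightarrow> real" where
  "bcc_value x y k = Inf {\<theta>. \<exists>l. bcc_feasible x y k \<theta> l}"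

lemma bcc_optimal_imp_value:
  assumes "bcc_optimal x y k \<theta> l"
  shows "bcc_value x y k = \<theta>"
  unfolding bcc_value_def
  by (rule cInf_eq_minimum) (use assms in \<open>auto simp: bcc_optimal_def\<close>)

definition reference_set ::
  "('n::finite \<Rightarrow> real^'m) \<Rightarrow> ('n \<Rightarrow> real^'s) \<Rightarrow> 'n \<Rightarrow> 'n set \<Rightarrow> bool" where
  "reference_set x y k R \<longleftrightarrow>
     (\<exists>l. bcc_optimal x y k (bcc_value x y k) l \<and> R = {j. l $ j > 0})"

definition maximal_reference_set ::
  "('n::finite \<Rightarrow> real^'m) \<Rightarrow> ('n \<Rightarrow> real^'s) \<Rightarrow> 'n \<Rightarrow> 'n set" where
  "maximal_reference_set x y k = \<Union>{R. reference_set x y k R}"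

text \<open>The mixed integer program, with \<open>u\<close> the free variable \<open>u\<^sub>o\<close> and \<open>b\<close> the
  vector \<open>I\<close> of binary variables.\<close>

definition milp_feasible ::
  "('n::finite \<Rightarrow> real^'m) \<Rightarrow> ('n \<Rightarrow> real^'s) \<Rightarrow> 'n \<Rightarrow> real \<Rightarrow>
   real^'s \<Rightarrow> real^'m \<Rightarrow> real \<Rightarrow> real^'n \<Rightarrow> real^'n \<Rightarrow> bool" where
  "milp_feasible x y k M U V u t b \<longleftrightarrow>
     U \<bullet> y k + u = bcc_value x y k \<and>
     V \<bullet> x k = 1 \<and>
     (\<forall>j. U \<bullet> y j - V \<bullet> x j + u + t $ j = 0) \<and>
     (\<forall>j. b $ j \<le> M * t $ j) \<and>
     (\<forall>r. U $ r \<ge> 0) \<and> (\<forall>i. V $ i \<ge> 0) \<and>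
     (\<forall>j. b $ j \<in> {0, 1}) \<and> (\<forall>j. t $ j \<ge> 0)"

definition milp_optimal ::
  "('n::finite \<Rightarrow> real^'m) \<Rightarrow> ('n \<Rightarrow> real^'s) \<Rightarrow> 'n \<Rightarrow> real \<Rightarrow>
   real^'s \<Rightarrow> real^'m \<Rightarrow> real \<Rightarrow> real^'n \<Rightarrow> real^'n \<Rightarrow> bool" where
  "milp_optimal x y k M U V u t b \<longleftrightarrow>
     milp_feasible x y k M U V u t b \<and>
     (\<forall>U' V' u' t' b'. milp_feasible x y k M U' V' u' t' b' \<longrightarrow>
        (\<Sum>j\<in>UNIV. b' $ j) \<le> (\<Sum>j\<in>UNIV. b $ j))"

end

theory Submission
  imports Defs
begin

text \<open>
  The optimal dual multipliers of the envelopment model, without the normalization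
  \<open>V \<bullet> x k = 1\<close>, form the dual of a finitely generated cone.  Finitely generated cones are
  closed, so separation yields, for every DMU outside the maximal reference set, a multiplier with
  positive slack at that DMU.  The sum of these multipliers has positive slack at all such DMUs at
  once and, once normalized, fixes the threshold for \<open>M\<close>.  Complementary slackness forces
  zero slack on the maximal reference set.
\<close>

section \<open>Separation from finitely generated cones\<close>

lemma convex_cone_separation:
  fixes K :: "'a::euclidean_space set"
  assumes "convex_cone K" "closed K" "w \<notin> K"
  obtains z where "\<And>g. g \<in> K \<Longrightarrow> 0 \<le> z \<bullet> g" "z \<bullet> w < 0"
proof -
  obtain z b where zw: "z \<bullet> w < b" and zK: "\<And>g. g \<in> K \<Longrightarrow> b < z \<bullet> g"
    using separating_hyperplane_closed_point[of K w] assms unfolding convex_cone_def by blast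
  have b: "b < 0"
    using zK[OF convex_cone_contains_0[OF assms(1)]] by simp
  have "0 \<le> z \<bullet> g" if "g \<in> K" for g
  proof (rule ccontr)
    assume neg: "\<not> 0 \<le> z \<bullet> g"
    \<comment> \<open>Both numbers are negative, so the factor is positive and the scaled point
      stays in \<open>K\<close>. Its product with \<open>z\<close> is exactly \<open>b\<close>,
      which the strict bound over \<open>K\<close> excludes.\<close>
    then have "(b / (z \<bullet> g)) *\<^sub>R g \<in> K"
      using b that assms(1) by (intro convex_cone_scaleR) (auto simp: divide_nonpos_neg)
    from zK[OF this] neg show False by simp
  qed
  with zw b show thesis by (intro that[of z]) auto
qed

lemma strictly_positive_functional:
  fixes G :: "'a::euclidean_space set"
  assumes "finite G" "W \<subseteq> G" "\<And>w. w \<in> W \<Longrightarrow> - w \<notin> convex_cone hull G"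
  obtains z where "\<And>g. g \<in> G \<Longrightarrow> 0 \<le> z \<bullet> g" "\<And>w. w \<in> W \<Longrightarrow> 0 < z \<bullet> w"
proof -
  have "\<exists>z. (\<forall>g\<in>G. 0 \<le> z \<bullet> g) \<and> 0 < z \<bullet> w" if "w \<in> W" for w
  proof -
    from assms(3)[OF that]
    obtain z where "\<And>g. g \<in> convex_cone hull G \<Longrightarrow> 0 \<le> z \<bullet> g" "z \<bullet> (- w) < 0"
      by (rule convex_cone_separation[OF convex_cone_convex_cone_hull
          closed_convex_cone_hull[OF assms(1)]]) blast
    then show ?thesis by (intro exI[of _ z]) (auto simp: hull_inc)
  qed
  then obtain Z where Z: "\<And>w g. w \<in> W \<Longrightarrow> g \<in> G \<Longrightarrow> 0 \<le> Z w \<bullet> g"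
    "\<And>w. w \<in> W \<Longrightarrow> 0 < Z w \<bullet> w" by metis
  have finW: "finite W" using assms(1,2) finite_subset by blast
  show thesis
  \<comment> \<open>Since \<open>W\<close> lies in \<open>G\<close>, every summand is nonnegative on
    \<open>W\<close>. The positive contribution of \<open>Z v\<close> at \<open>v\<close> therefore
    cannot be cancelled.\<close>
  proof (rule that[of "\<Sum>w\<in>W. Z w"])
    show "0 \<le> (\<Sum>w\<in>W. Z w) \<bullet> g" if "g \<in> G" for g
      using Z(1) that by (auto simp: inner_sum_left intro: sum_nonneg)
    show "0 < (\<Sum>w\<in>W. Z w) \<bullet> v" if "v \<in> W" for v
      unfolding inner_sum_left using finW that Z assms(2) by (intro sum_pos2[of W v]) auto
  qed
qed

section \<open>Optimal value and reference weights of the envelopment model\<close>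

lemma inner_le_componentwise:
  fixes V a b :: "real^'m::finite"
  assumes "\<And>i. 0 \<le> V $ i" "\<And>i. a $ i \<le> b $ i"
  shows "V \<bullet> a \<le> V \<bullet> b"
  unfolding inner_vec_def using assms by (auto intro!: sum_mono mult_left_mono)

text \<open>\<open>Inf\<close> on the reals bounds a set only if the set is bounded below. A
  coordinate where the input of DMU \<open>k\<close> is positive supplies the bound 0: the left-hand
  side of that constraint is nonnegative.\<close>

lemma bcc_value_le:
  fixes x :: "'n::finite \<Rightarrow> real^'m::finite" and y :: "'n \<Rightarrow> real^'s::finite"
  assumes x: "\<And>j i. 0 \<le> x j $ i" and xk: "x k \<noteq> 0" and feas: "bcc_feasible x y k \<theta> l"
  shows "bcc_value x y k \<le> \<theta>"
  unfolding bcc_value_def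
proof (rule cInf_lower)
  show "\<theta> \<in> {\<theta>. \<exists>l. bcc_feasible x y k \<theta> l}" using feas by blast
  obtain i where "x k $ i \<noteq> 0" using xk by (auto simp: vec_eq_iff)
  then have i: "0 < x k $ i" using x[of k i] by simp
  show "bdd_below {\<theta>. \<exists>l. bcc_feasible x y k \<theta> l}"
  proof (rule bdd_belowI[of _ 0], clarify)
    fix \<theta>' l' assume f: "bcc_feasible x y k \<theta>' l'"
    have "0 \<le> (\<Sum>j\<in>UNIV. l' $ j * x j $ i)"
      using f x by (intro sum_nonneg) (auto simp: bcc_feasible_def)
    also have "\<dots> \<le> \<theta>' * x k $ i" using f by (auto simp: bcc_feasible_def)
    finally show "0 \<le> \<theta>'" using i by (simp add: zero_le_mult_iff)
  qed
qed

lemma mem_maximal_reference_set_iff: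
  "j \<in> maximal_reference_set x y k \<longleftrightarrow> (\<exists>l. bcc_optimal x y k (bcc_value x y k) l \<and> 0 < l $ j)"
  unfolding maximal_reference_set_def reference_set_def by auto

text \<open>Feasibility at the infimum is already optimality, so attainment of the optimum need not
  be shown separately.\<close>

lemma maximal_reference_setI:
  fixes x :: "'n::finite \<Rightarrow> real^'m::finite" and y :: "'n \<Rightarrow> real^'s::finite"
  assumes x: "\<And>j i. 0 \<le> x j $ i" and xk: "x k \<noteq> 0"
    and feas: "bcc_feasible x y k (bcc_value x y k) l" and "0 < l $ j"
  shows "j \<in> maximal_reference_set x y k"
  unfolding mem_maximal_reference_set_iff bcc_optimal_def
  using bcc_value_le[where x=x and k=k, OF x xk] assms(3,4) by blast

section \<open>The cone behind the envelopment constraints\<close>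

text \<open>The generators of \<open>strict_multiplier\<close> span a subset of this cone: \<open>l\<close> and
  \<open>\<sigma>\<close> are the coefficients of \<open>(x j, - y j, - 1)\<close> and
  \<open>- (\<theta> x\<^sub>k, - y\<^sub>k, - 1)\<close>, and the inequalities absorb the unit vectors.\<close>

definition bcc_cone ::
  "('n::finite \<Rightarrow> real^'m) \<Rightarrow> ('n \<Rightarrow> real^'s) \<Rightarrow> 'n \<Rightarrow> real \<Rightarrow> ((real^'m) \<times> (real^'s) \<times> real) set" where
  "bcc_cone x y k \<theta> = {(a, b, c). \<exists>l \<sigma>. (\<forall>j. 0 \<le> l j) \<and>
     (\<forall>i. (\<Sum>j\<in>UNIV. l j * x j $ i) - \<sigma> * \<theta> * x k $ i \<le> a $ i) \<and>
     (\<forall>r. \<sigma> * y k $ r - (\<Sum>j\<in>UNIV. l j * y j $ r) \<le> b $ r) \<and>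
     c = \<sigma> - (\<Sum>j\<in>UNIV. l j)}"

lemma bcc_coneI:
  assumes "\<And>j. 0 \<le> l j"
    and "\<And>i. (\<Sum>j\<in>UNIV. l j * x j $ i) - \<sigma> * \<theta> * x k $ i \<le> a $ i"
    and "\<And>r. \<sigma> * y k $ r - (\<Sum>j\<in>UNIV. l j * y j $ r) \<le> b $ r"
    and "c = \<sigma> - (\<Sum>j\<in>UNIV. l j)"
  shows "(a, b, c) \<in> bcc_cone x y k \<theta>"
  unfolding bcc_cone_def using assms by blast

lemma bcc_coneE:
  assumes "(a, b, c) \<in> bcc_cone x y k \<theta>"
  obtains l \<sigma> where "\<And>j. 0 \<le> l j"
    "\<And>i. (\<Sum>j\<in>UNIV. l j * x j $ i) - \<sigma> * \<theta> * x k $ i \<le> a $ i"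
    "\<And>r. \<sigma> * y k $ r - (\<Sum>j\<in>UNIV. l j * y j $ r) \<le> b $ r"
    "c = \<sigma> - (\<Sum>j\<in>UNIV. l j)"
  using assms unfolding bcc_cone_def by blast

lemma convex_cone_bcc_cone: "convex_cone (bcc_cone x y k \<theta>)"
  unfolding convex_cone_iff
proof (intro conjI ballI allI impI)
  show "0 \<in> bcc_cone x y k \<theta>"
    unfolding zero_prod_def by (rule bcc_coneI[of "\<lambda>_. 0" _ 0]) auto
next
  fix p q assume "p \<in> bcc_cone x y k \<theta>" "q \<in> bcc_cone x y k \<theta>"
  moreover obtain a b c a' b' c' where pq: "p = (a, b, c)" "q = (a', b', c')"
    by (metis surj_pair)
  ultimately have "(a, b, c) \<in> bcc_cone x y k \<theta>" "(a', b', c') \<in> bcc_cone x y k \<theta>"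
    by simp_all
  then obtain l \<sigma> l' \<sigma>' where *: "\<And>j. 0 \<le> l j"
    "\<And>i. (\<Sum>j\<in>UNIV. l j * x j $ i) - \<sigma> * \<theta> * x k $ i \<le> a $ i"
    "\<And>r. \<sigma> * y k $ r - (\<Sum>j\<in>UNIV. l j * y j $ r) \<le> b $ r"
    "c = \<sigma> - (\<Sum>j\<in>UNIV. l j)" "\<And>j. 0 \<le> l' j"
    "\<And>i. (\<Sum>j\<in>UNIV. l' j * x j $ i) - \<sigma>' * \<theta> * x k $ i \<le> a' $ i"
    "\<And>r. \<sigma>' * y k $ r - (\<Sum>j\<in>UNIV. l' j * y j $ r) \<le> b' $ r"
    "c' = \<sigma>' - (\<Sum>j\<in>UNIV. l' j)"
    by (elim bcc_coneE) blast
  have "(a + a', b + b', c + c') \<in> bcc_cone x y k \<theta>"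
  proof (rule bcc_coneI[of "\<lambda>j. l j + l' j" _ "\<sigma> + \<sigma>'"])
    show "0 \<le> l j + l' j" for j using *(1,5)[of j] by simp
    show "(\<Sum>j\<in>UNIV. (l j + l' j) * x j $ i) - (\<sigma> + \<sigma>') * \<theta> * x k $ i \<le> (a + a') $ i" for i
      using *(2,6)[of i] by (simp add: distrib_right sum.distrib)
    show "(\<sigma> + \<sigma>') * y k $ r - (\<Sum>j\<in>UNIV. (l j + l' j) * y j $ r) \<le> (b + b') $ r" for r
      using *(3,7)[of r] by (simp add: distrib_right sum.distrib)
    show "c + c' = \<sigma> + \<sigma>' - (\<Sum>j\<in>UNIV. l j + l' j)"
      using *(4,8) by (simp add: sum.distrib)
  qed
  then show "p + q \<in> bcc_cone x y k \<theta>" by (simp add: pq)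
next
  fix p and d :: real assume "p \<in> bcc_cone x y k \<theta>" and d: "0 \<le> d"
  moreover obtain a b c where p: "p = (a, b, c)" by (metis surj_pair)
  ultimately have "(a, b, c) \<in> bcc_cone x y k \<theta>" by simp
  then obtain l \<sigma> where *: "\<And>j. 0 \<le> l j"
    "\<And>i. (\<Sum>j\<in>UNIV. l j * x j $ i) - \<sigma> * \<theta> * x k $ i \<le> a $ i"
    "\<And>r. \<sigma> * y k $ r - (\<Sum>j\<in>UNIV. l j * y j $ r) \<le> b $ r"
    "c = \<sigma> - (\<Sum>j\<in>UNIV. l j)"
    by (rule bcc_coneE) blast
  have "(d *\<^sub>R a, d *\<^sub>R b, d * c) \<in> bcc_cone x y k \<theta>"
  proof (rule bcc_coneI[of "\<lambda>j. d * l j" _ "d * \<sigma>"])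
    show "0 \<le> d * l j" for j using *(1)[of j] d by simp
    show "(\<Sum>j\<in>UNIV. d * l j * x j $ i) - d * \<sigma> * \<theta> * x k $ i \<le> (d *\<^sub>R a) $ i" for i
      using mult_left_mono[OF *(2)[of i] d]
      by (simp add: sum_distrib_left right_diff_distrib mult.assoc)
    show "d * \<sigma> * y k $ r - (\<Sum>j\<in>UNIV. d * l j * y j $ r) \<le> (d *\<^sub>R b) $ r" for r
      using mult_left_mono[OF *(3)[of r] d]
      by (simp add: sum_distrib_left right_diff_distrib mult.assoc)
    show "d * c = d * \<sigma> - (\<Sum>j\<in>UNIV. d * l j)"
      using *(4) by (simp add: sum_distrib_left right_diff_distrib)
  qed
  then show "d *\<^sub>R p \<in> bcc_cone x y k \<theta>" by (simp add: p)
qed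

text \<open>The cone is homogeneous, with total weight \<sigma> in place of 1. Division by \<sigma>
  leads back to the envelopment model.\<close>

lemma bcc_feasible_scaled:
  fixes l :: "'n::finite \<Rightarrow> real"
  assumes "0 < \<sigma>" "\<And>j. 0 \<le> l j" "(\<Sum>j\<in>UNIV. l j) = \<sigma>"
    and "\<And>i. (\<Sum>j\<in>UNIV. l j * x j $ i) \<le> \<sigma> * \<theta> * x k $ i"
    and "\<And>r. \<sigma> * y k $ r \<le> (\<Sum>j\<in>UNIV. l j * y j $ r)"
  shows "bcc_feasible x y k \<theta> (\<chi> j. l j / \<sigma>)"
  unfolding bcc_feasible_def
proof (intro conjI allI)
  show "(\<Sum>j\<in>UNIV. (\<chi> j. l j / \<sigma>) $ j * x j $ i) \<le> \<theta> * x k $ i" for i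
    using assms(1) assms(4)[of i]
    by (simp add: sum_divide_distrib[symmetric] divide_le_eq mult_ac)
  show "y k $ r \<le> (\<Sum>j\<in>UNIV. (\<chi> j. l j / \<sigma>) $ j * y j $ r)" for r
    using assms(1) assms(5)[of r]
    by (simp add: sum_divide_distrib[symmetric] le_divide_eq mult_ac)
qed (use assms(1-3) in \<open>simp_all add: sum_divide_distrib[symmetric]\<close>)

text \<open>Cone coefficients for this vector would produce inputs at most (\<sigma> \<theta> - 1)
  times those of DMU \<open>k\<close>. After division by \<sigma> the value \<theta> - 1/\<sigma>
  would be feasible, below the infimum. The case \<sigma> = 0 would force the input of DMU
  \<open>k\<close> to vanish.\<close>

lemma neg_input_notin_bcc_cone:
  fixes x :: "'n::finite \<Rightarrow> real^'m::finite" and y :: "'n \<Rightarrow> real^'s::finite"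
  assumes x: "\<And>j i. 0 \<le> x j $ i" and xk: "x k \<noteq> 0"
  shows "- (x k, 0, 0) \<notin> bcc_cone x y k (bcc_value x y k)"
proof
  let ?\<theta> = "bcc_value x y k"
  assume "- (x k, 0, 0) \<in> bcc_cone x y k ?\<theta>"
  then have "(- x k, 0, 0) \<in> bcc_cone x y k ?\<theta>" by simp
  then obtain l \<sigma> where *: "\<And>j. 0 \<le> l j"
    "\<And>i. (\<Sum>j\<in>UNIV. l j * x j $ i) - \<sigma> * ?\<theta> * x k $ i \<le> (- x k) $ i"
    "\<And>r. \<sigma> * y k $ r - (\<Sum>j\<in>UNIV. l j * y j $ r) \<le> 0 $ r"
    "0 = \<sigma> - (\<Sum>j\<in>UNIV. l j)" by (rule bcc_coneE) blast
  have \<sigma>: "\<sigma> = (\<Sum>j\<in>UNIV. l j)" using *(4) by simp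
  have "0 \<le> \<sigma>" unfolding \<sigma> using *(1) by (simp add: sum_nonneg)
  moreover have "\<sigma> \<noteq> 0"
  proof
    assume "\<sigma> = 0"
    have "x k $ i = 0" for i
    proof -
      have "0 \<le> (\<Sum>j\<in>UNIV. l j * x j $ i)" using *(1) x by (intro sum_nonneg) simp
      then show ?thesis using *(2)[of i] x[of k i] \<open>\<sigma> = 0\<close> by simp
    qed
    then show False using xk by (simp add: vec_eq_iff)
  qed
  ultimately have pos: "0 < \<sigma>" by simp
  have "bcc_feasible x y k (?\<theta> - 1 / \<sigma>) (\<chi> j. l j / \<sigma>)"
  proof (rule bcc_feasible_scaled[OF pos])
    show "(\<Sum>j\<in>UNIV. l j * x j $ i) \<le> \<sigma> * (?\<theta> - 1 / \<sigma>) * x k $ i" for i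
      using *(2)[of i] pos by (simp add: right_diff_distrib left_diff_distrib)
    show "\<sigma> * y k $ r \<le> (\<Sum>j\<in>UNIV. l j * y j $ r)" for r using *(3)[of r] by simp
  qed (use *(1) \<sigma> in auto)
  from bcc_value_le[where x=x and k=k, OF x xk this] pos show False by simp
qed

text \<open>Moving the negated DMU to the other side adds one unit of weight at \<open>j\<close>.
  The normalized weights would then be feasible at the optimal value and positive at
  \<open>j\<close>, making \<open>j\<close> a reference DMU.\<close>

lemma neg_dmu_notin_bcc_cone:
  fixes x :: "'n::finite \<Rightarrow> real^'m::finite" and y :: "'n \<Rightarrow> real^'s::finite"
  assumes x: "\<And>j i. 0 \<le> x j $ i" and xk: "x k \<noteq> 0"
    and j: "j \<notin> maximal_reference_set x y k"
  shows "- (x j, - y j, - 1) \<notin> bcc_cone x y k (bcc_value x y k)"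
proof
  let ?\<theta> = "bcc_value x y k"
  assume "- (x j, - y j, - 1) \<in> bcc_cone x y k ?\<theta>"
  then have "(- x j, y j, 1) \<in> bcc_cone x y k ?\<theta>" by simp
  then obtain l \<sigma> where *: "\<And>j. 0 \<le> l j"
    "\<And>i. (\<Sum>j\<in>UNIV. l j * x j $ i) - \<sigma> * ?\<theta> * x k $ i \<le> (- x j) $ i"
    "\<And>r. \<sigma> * y k $ r - (\<Sum>j\<in>UNIV. l j * y j $ r) \<le> y j $ r"
    "1 = \<sigma> - (\<Sum>j\<in>UNIV. l j)" by (rule bcc_coneE) blast
  define l' where "l' = (\<lambda>i. l i + (if i = j then 1 else 0))"
  \<comment> \<open>The arbitrary \<open>f\<close> covers inputs, outputs and, with \<open>f\<close>
    constantly 1, the total weight.\<close>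
  have l': "(\<Sum>i\<in>UNIV. l' i * f i) = (\<Sum>i\<in>UNIV. l i * f i) + f j" for f
    by (simp add: l'_def distrib_right sum.distrib if_distrib[of "\<lambda>c. c * _"] cong: if_cong)
  have \<sigma>: "\<sigma> = 1 + (\<Sum>j\<in>UNIV. l j)" using *(4) by simp
  have pos: "0 < \<sigma>" unfolding \<sigma> using *(1) by (simp add: add_pos_nonneg sum_nonneg)
  have "bcc_feasible x y k ?\<theta> (\<chi> i. l' i / \<sigma>)"
  proof (rule bcc_feasible_scaled[OF pos])
    show "0 \<le> l' i" for i using *(1)[of i] by (simp add: l'_def)
    show "(\<Sum>i\<in>UNIV. l' i) = \<sigma>" using l'[of "\<lambda>_. 1"] \<sigma> by simp
    show "(\<Sum>j\<in>UNIV. l' j * x j $ i) \<le> \<sigma> * ?\<theta> * x k $ i" for i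
      using *(2)[of i] l'[of "\<lambda>j. x j $ i"] by simp
    show "\<sigma> * y k $ r \<le> (\<Sum>j\<in>UNIV. l' j * y j $ r)" for r
      using *(3)[of r] l'[of "\<lambda>j. y j $ r"] by simp
  qed
  moreover have "0 < (\<chi> i. l' i / \<sigma>) $ j"
    using pos *(1)[of j] by (simp add: l'_def add_nonneg_pos)
  ultimately show False using maximal_reference_setI[where x=x and k=k, OF x xk] j by blast
qed

section \<open>A multiplier with positive slack outside the maximal reference set\<close>

lemma strict_multiplier:
  fixes x :: "'n::finite \<Rightarrow> real^'m::finite" and y :: "'n \<Rightarrow> real^'s::finite"
  assumes x: "\<And>j i. 0 \<le> x j $ i" and xk: "x k \<noteq> 0"
  obtains U V u where "\<And>r. 0 \<le> U $ r" "\<And>i. 0 \<le> V $ i" "V \<bullet> x k = 1"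
    "U \<bullet> y k + u = bcc_value x y k"
    "\<And>j. 0 \<le> V \<bullet> x j - U \<bullet> y j - u"
    "\<And>j. j \<notin> maximal_reference_set x y k \<Longrightarrow> 0 < V \<bullet> x j - U \<bullet> y j - u"
proof -
  let ?\<theta> = "bcc_value x y k"
  define g where "g = (\<lambda>j. (x j, - y j, - 1 :: real))"
  define h where "h = (?\<theta> *\<^sub>R x k, - y k, - 1 :: real)"
  \<comment> \<open>For \<open>z = (V, U, u)\<close>, nonnegativity on the unit vectors gives the
    signs of \<open>V\<close> and \<open>U\<close>, and on \<open>g j\<close> the slack inequality
    for DMU \<open>j\<close>. Having both \<open>h\<close> and \<open>- h\<close> turns the
    condition at DMU \<open>k\<close> into an equation.\<close>
  define G where "G = insert (x k, 0, 0) (insert h (insert (- h) (range g \<union>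
    range (\<lambda>i. (axis i 1, 0, 0)) \<union> range (\<lambda>r. (0, axis r 1, 0)))))"
  \<comment> \<open>The vector \<open>(x k, 0, 0)\<close> is included so that
    \<open>V \<bullet> x k\<close> becomes positive and can be normalized to 1.\<close>
  define W where "W = insert (x k, 0, 0) (g ` (- maximal_reference_set x y k))"
  have "g j \<in> bcc_cone x y k ?\<theta>" for j
    unfolding g_def
    by (rule bcc_coneI[of "\<lambda>i. if i = j then 1 else 0" _ 0])
       (simp_all add: if_distrib[of "\<lambda>c. c * _"] cong: if_cong)
  moreover have "h \<in> bcc_cone x y k ?\<theta>" "- h \<in> bcc_cone x y k ?\<theta>"
    unfolding h_def uminus_Pair
    by (rule bcc_coneI[of "\<lambda>_. 0" _ "-1"] bcc_coneI[of "\<lambda>_. 0" _ 1], simp_all)+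
  moreover have "(x k, 0, 0) \<in> bcc_cone x y k ?\<theta>"
    "(axis i 1, 0, 0) \<in> bcc_cone x y k ?\<theta>" "(0, axis r 1, 0) \<in> bcc_cone x y k ?\<theta>" for i r
    by (rule bcc_coneI[of "\<lambda>_. 0" _ 0]; simp add: x axis_def)+
  ultimately have "G \<subseteq> bcc_cone x y k ?\<theta>" unfolding G_def by auto
  \<comment> \<open>The finitely generated hull is closed, as separation requires; the larger cone,
    with its explicit coefficients, serves to refute membership.\<close>
  then have hull: "convex_cone hull G \<subseteq> bcc_cone x y k ?\<theta>"
    by (rule hull_minimal) (rule convex_cone_bcc_cone)
  have notin: "- w \<notin> convex_cone hull G" if "w \<in> W" for w
    using that hull neg_input_notin_bcc_cone[where x=x and k=k and y=y, OF x xk] neg_dmu_notin_bcc_cone[where x=x and k=k and y=y, OF x xk]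
    unfolding W_def g_def by blast
  have "finite G" "W \<subseteq> G" by (auto simp: G_def W_def)
  then obtain z where z: "\<And>g. g \<in> G \<Longrightarrow> 0 \<le> z \<bullet> g" "\<And>w. w \<in> W \<Longrightarrow> 0 < z \<bullet> w"
    using strictly_positive_functional[OF _ _ notin] by blast
  obtain V U u where zVUu: "z = (V, U, u)" by (metis surj_pair)
  define \<tau> where "\<tau> = V \<bullet> x k"
  have \<tau>: "0 < \<tau>" using z(2)[of "(x k, 0, 0)"] by (simp add: W_def zVUu \<tau>_def)
  have slack: "z \<bullet> g j = V \<bullet> x j - U \<bullet> y j - u" for j by (simp add: g_def zVUu)
  have scaled: "(V /\<^sub>R \<tau>) \<bullet> x j - (U /\<^sub>R \<tau>) \<bullet> y j - u / \<tau> = (V \<bullet> x j - U \<bullet> y j - u) / \<tau>" for j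
    by (simp add: divide_inverse_commute right_diff_distrib)
  have zh: "z \<bullet> h = 0" using z(1)[of h] z(1)[of "- h"] by (simp add: G_def)
  show thesis
  proof (rule that[of "U /\<^sub>R \<tau>" "V /\<^sub>R \<tau>" "u / \<tau>"])
    show "0 \<le> (U /\<^sub>R \<tau>) $ r" for r
      using z(1)[of "(0, axis r 1, 0)"] \<tau> by (simp add: G_def zVUu inner_axis)
    show "0 \<le> (V /\<^sub>R \<tau>) $ i" for i
      using z(1)[of "(axis i 1, 0, 0)"] \<tau> by (simp add: G_def zVUu inner_axis)
    show "(V /\<^sub>R \<tau>) \<bullet> x k = 1" using \<tau> by (simp add: \<tau>_def)
    have "U \<bullet> y k + u = ?\<theta> * \<tau>" using zh by (simp add: h_def zVUu \<tau>_def)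
    then show "(U /\<^sub>R \<tau>) \<bullet> y k + u / \<tau> = ?\<theta>" using \<tau> by (simp add: field_simps)
    show "0 \<le> (V /\<^sub>R \<tau>) \<bullet> x j - (U /\<^sub>R \<tau>) \<bullet> y j - u / \<tau>" for j
      unfolding scaled using z(1)[of "g j"] \<tau> by (simp add: G_def slack)
    show "0 < (V /\<^sub>R \<tau>) \<bullet> x j - (U /\<^sub>R \<tau>) \<bullet> y j - u / \<tau>"
      if "j \<notin> maximal_reference_set x y k" for j
      unfolding scaled using z(2)[of "g j"] \<tau> that by (simp add: W_def slack)
  qed
qed

section \<open>Complementary slackness and the threshold for \<open>M\<close>\<close>

lemma milp_feasible_complementary_slackness:
  fixes x :: "'n::finite \<Rightarrow> real^'m::finite" and y :: "'n \<Rightarrow> real^'s::finite"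
  assumes feas: "milp_feasible x y k M U V u t b" and j: "j \<in> maximal_reference_set x y k"
  shows "t $ j = 0"
proof -
  let ?\<theta> = "bcc_value x y k"
  obtain l where l: "bcc_feasible x y k ?\<theta> l" "0 < l $ j"
    using j unfolding mem_maximal_reference_set_iff bcc_optimal_def by blast
  have t: "t $ i = V \<bullet> x i - U \<bullet> y i - u" for i
  proof -
    have "U \<bullet> y i - V \<bullet> x i + u + t $ i = 0" using feas by (simp add: milp_feasible_def)
    then show ?thesis by linarith
  qed
  \<comment> \<open>The slacks weighted by an optimal \<open>l\<close> sum to at most 0 by the
    primal and dual constraints. Each term is nonnegative, so each vanishes, and
    \<open>l $ j\<close> is positive.\<close>
  have "(\<Sum>i\<in>UNIV. l $ i * t $ i)
      = V \<bullet> (\<Sum>i\<in>UNIV. l $ i *\<^sub>R x i) - U \<bullet> (\<Sum>i\<in>UNIV. l $ i *\<^sub>R y i) - (\<Sum>i\<in>UNIV. l $ i) * u"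
    by (simp add: t inner_sum_right right_diff_distrib sum_subtractf sum_distrib_right)
  also have "(\<Sum>i\<in>UNIV. l $ i) = 1" using l(1) by (simp add: bcc_feasible_def)
  also have "V \<bullet> (\<Sum>i\<in>UNIV. l $ i *\<^sub>R x i) \<le> V \<bullet> (?\<theta> *\<^sub>R x k)"
    using feas l(1) by (intro inner_le_componentwise) (auto simp: milp_feasible_def bcc_feasible_def)
  also have "V \<bullet> (?\<theta> *\<^sub>R x k) = ?\<theta>" using feas by (simp add: milp_feasible_def)
  finally have "(\<Sum>i\<in>UNIV. l $ i * t $ i) \<le> ?\<theta> - U \<bullet> (\<Sum>i\<in>UNIV. l $ i *\<^sub>R y i) - u" by simp
  also have "\<dots> \<le> ?\<theta> - U \<bullet> y k - u"
    using feas l(1) inner_le_componentwise[of U "y k" "\<Sum>i\<in>UNIV. l $ i *\<^sub>R y i"]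
    by (simp add: milp_feasible_def bcc_feasible_def)
  also have "\<dots> = 0" using feas by (simp add: milp_feasible_def)
  finally have le: "(\<Sum>i\<in>UNIV. l $ i * t $ i) \<le> 0" .
  have nn: "0 \<le> l $ i * t $ i" for i
    using feas l(1) by (simp add: milp_feasible_def bcc_feasible_def)
  have "(\<Sum>i\<in>UNIV. l $ i * t $ i) = 0" using le nn by (simp add: antisym sum_nonneg)
  then have "l $ j * t $ j = 0" using nn by (simp add: sum_nonneg_eq_0_iff)
  then show ?thesis using l(2) by simp
qed

theorem theorem2:
  fixes x :: "'n::finite \<Rightarrow> real^'m::finite" and y :: "'n \<Rightarrow> real^'s::finite" and k :: 'n
  assumes "\<And>j i. x j $ i \<ge> 0" and "\<And>j r. y j $ r \<ge> 0"
    and "\<And>j. x j \<noteq> 0" and "\<And>j. y j \<noteq> 0"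
  shows "\<exists>M0>0. \<forall>M\<ge>M0. \<forall>U V u t b.
           milp_optimal x y k M U V u t b \<longrightarrow>
           {j. t $ j = 0} = maximal_reference_set x y k"
proof -
  define R where "R = maximal_reference_set x y k"
  obtain U0 V0 u0 where dual: "\<And>r. 0 \<le> U0 $ r" "\<And>i. 0 \<le> V0 $ i" "V0 \<bullet> x k = 1"
    "U0 \<bullet> y k + u0 = bcc_value x y k" "\<And>j. 0 \<le> V0 \<bullet> x j - U0 \<bullet> y j - u0"
    "\<And>j. j \<notin> R \<Longrightarrow> 0 < V0 \<bullet> x j - U0 \<bullet> y j - u0"
    using strict_multiplier[where x=x and k=k and y=y, OF assms(1,3)] unfolding R_def by blast
  define s where "s = (\<lambda>j. V0 \<bullet> x j - U0 \<bullet> y j - u0)"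
  \<comment> \<open>A binary 1 at slack \<open>s j\<close> requires \<open>M\<close> to be at least
    \<open>1 / s j\<close>. The sum dominates all these reciprocals at once, and the leading 1 keeps
    \<open>M0\<close> positive even when \<open>-R\<close> is empty.\<close>
  define M0 where "M0 = 1 + (\<Sum>j\<in>-R. 1 / s j)"
  define b0 :: "real^'n" where "b0 = (\<chi> j. if j \<in> R then 0 else 1)"
  have s: "\<And>j. 0 \<le> s j" "\<And>j. j \<notin> R \<Longrightarrow> 0 < s j" using dual(5,6) by (auto simp: s_def)
  have M0: "0 < M0" unfolding M0_def using s(1) by (intro add_pos_nonneg sum_nonneg) auto
  have M0s: "1 / s j \<le> M0" if "j \<notin> R" for j
    using member_le_sum[of j "-R" "\<lambda>j. 1 / s j"] s(1) that unfolding M0_def by auto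
  have "{j. t $ j = 0} = R" if "M0 \<le> M" and opt: "milp_optimal x y k M U V u t b" for M U V u t b
  proof
    have feas: "milp_feasible x y k M U V u t b" using opt by (simp add: milp_optimal_def)
    show R: "R \<subseteq> {j. t $ j = 0}"
      using milp_feasible_complementary_slackness[OF feas] by (auto simp: R_def)
    have b: "b $ j \<in> {0, 1}" "b $ j \<le> M * t $ j" for j
      using feas by (auto simp: milp_feasible_def)
    have "b0 $ j \<le> M * s j" for j
    proof (cases "j \<in> R")
      case True
      then show ?thesis using s(1)[of j] M0 that(1) by (simp add: b0_def)
    next
      case False
      then have "1 / s j \<le> M" using M0s that(1) by force
      with False show ?thesis using s(2)[of j] by (simp add: b0_def divide_le_eq)
    qed
    \<comment> \<open>This competitor sets every binary outside \<open>R\<close> to 1, so an optimal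
      \<open>b\<close> must have at least as large a sum.\<close>
    then have "milp_feasible x y k M U0 V0 u0 (\<chi> j. s j) b0"
      using dual s(1) unfolding milp_feasible_def by (auto simp: s_def b0_def)
    then have sum: "(\<Sum>j\<in>UNIV. b0 $ j) \<le> (\<Sum>j\<in>UNIV. b $ j)"
      using opt by (simp add: milp_optimal_def)
    show "{j. t $ j = 0} \<subseteq> R"
    proof (rule subsetI, rule ccontr)
      fix j assume "j \<in> {j. t $ j = 0}" "j \<notin> R"
      \<comment> \<open>Zero slack forces \<open>b $ j = 0\<close> through the constraint with
        \<open>M\<close>, while \<open>b0 $ j = 1\<close>.\<close>
      then have "b $ j < b0 $ j" using b[of j] by (auto simp: b0_def)
      \<comment> \<open>On \<open>R\<close> the slack is zero by complementary slackness, so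
        \<open>b\<close> vanishes there just as \<open>b0\<close> does; elsewhere \<open>b0\<close>
        is 1.\<close>
      moreover have "b $ i \<le> b0 $ i" for i
        using b[of i] R by (auto simp: b0_def)
      ultimately have "(\<Sum>j\<in>UNIV. b $ j) < (\<Sum>j\<in>UNIV. b0 $ j)"
        by (intro sum_strict_mono_ex1) auto
      with sum show False by simp
    qed
  qed
  with M0 show ?thesis unfolding R_def by blast
qed

end
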